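(* Let $\gamma,\beta,r\in\mathbb{N}_0$ and $\alpha\in\mathbb{N}$ with $\alpha\mid\beta$ and $\alpha\mid\gamma$. Then for every integer $n\ge 0$, $$\mathcal{B}^{r,x}_{n,1}(\alpha,\beta,\gamma)=\sum_{k=0}^{n}d_{k,r}\,x^{k}\beta^{k}\,S(n,k,\alpha,\beta,\gamma).$$
   Context: $\mathbb{N}$ is the set of positive integers and $\mathbb{N}_0=\mathbb{N}\cup\{0\}$; $x$ is a variable (when a nonnegative integer, a number of colours); $0^0=1$. Factorial polynomials: $(t|\alpha)_n=\prod_{j=0}^{n-1}(t-j\alpha)$, with $(t|\alpha)_0=1$. Powers such as $(1+\alpha t)^{c/\alpha}$ denote the formal power series $\sum_{n\ge0}(c|\alpha)_n\,t^n/n!$. Generalized Stirling numbers $S(n,k,\alpha,\beta,\gamma)$ ($0\le k\le n$) are defined by the polynomial identity $$(t|\alpha)_n=\sum_{k=0}^{n}S(n,k,\alpha,\beta,\gamma)\,(t-\gamma|\beta)_k ,$$ and $S(n,k,\alpha,\beta,\gamma)=0$ for $k>n$. The $r$-derangement number $d_{k,r}$ is the number of derangements (permutations without fixed points) of $[k+r]=\{1,\dots,k+r\}$ in which the elements $1,\dots,r$ lie in distinct cycles; equivalently $$\sum_{k=0}^{\infty}d_{k,r}\frac{t^k}{k!}=\frac{t^re^{-t}}{(1-t)^{r+1}}.$$ The numbers $\mathcal{B}^{r,x}_{n,\lambda}(\alpha,\beta,\gamma)$ (here used with $\lambda=1$) are defined by the formal power series identity $$\sum_{n=0}^{\infty}\mathcal{B}^{r,x}_{n,\lambda}(\alpha,\beta,\gamma)\frac{t^n}{n!}=(1+\alpha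 t)^{\gamma/\alpha}\,\frac{u(t)^{r\lambda}\exp(-\lambda u(t))}{(1-u(t))^{(r+1)\lambda}},\qquad u(t)=x\big((1+\alpha t)^{\beta/\alpha}-1\big).$$ *)

theory Defs
  imports
    "HOL-Computational_Algebra.Formal_Power_Series"
    "HOL-Computational_Algebra.Polynomial"
    "HOL-Combinatorics.Orbits"
begin

text \<open>Scalars are taken in an arbitrary field of characteristic zero, so that the
  variable \<open>x\<close> of the statement may be any scalar, including a transcendental one
  such as \<open>fls_X\<close> in the Laurent series over \<open>rat\<close>.\<close>

text \<open>\<open>(t | \<alpha>)\<^sub>n\<close>; generic in the ring, so that \<open>t\<close> may also be
  a polynomial indeterminate.\<close>

definition factorial_poly :: "'a::comm_ring_1 \<Rightarrow> 'a \<Rightarrow> nat \<Rightarrow> 'a" where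
  "factorial_poly t \<alpha> n = (\<Prod>j<n. t - of_nat j * \<alpha>)"

text \<open>In the polynomial ring, \<open>[:0, 1:]\<close> is the indeterminate \<open>t\<close> and \<open>[:c:]\<close>
  the constant \<open>c\<close>, so the identity below is
  \<open>(t | \<alpha>)\<^sub>n = (\<Sum>k\<le>n. s k (t - \<gamma> | \<beta>)\<^sub>k)\<close>.\<close>

definition is_gen_stirling ::
    "nat \<Rightarrow> 'a::field_char_0 \<Rightarrow> 'a \<Rightarrow> 'a \<Rightarrow> (nat \<Rightarrow> 'a) \<Rightarrow> bool" where
  "is_gen_stirling n \<alpha> \<beta> \<gamma> s \<longleftrightarrow>
     factorial_poly [:0, 1:] [:\<alpha>:] n =
       (\<Sum>k\<le>n. smult (s k) (factorial_poly ([:0, 1:] - [:\<gamma>:]) [:\<beta>:] k)) \<and>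
     (\<forall>k>n. s k = 0)"

definition gen_stirling ::
    "nat \<Rightarrow> nat \<Rightarrow> 'a::field_char_0 \<Rightarrow> 'a \<Rightarrow> 'a \<Rightarrow> 'a" where
  "gen_stirling n k \<alpha> \<beta> \<gamma> = (THE s. is_gen_stirling n \<alpha> \<beta> \<gamma> s) k"

text \<open>The cycle of a permutation \<open>p\<close> of a finite set through \<open>i\<close> is \<open>orbit p i\<close>.\<close>

definition r_derangements :: "nat \<Rightarrow> nat \<Rightarrow> (nat \<Rightarrow> nat) set" where
  "r_derangements k r =
     {p. p permutes {1..k + r} \<and> (\<forall>i\<in>{1..k + r}. p i \<noteq> i) \<and>
         (\<forall>i\<in>{1..r}. \<forall>j\<in>{1..r}. i \<noteq> j \<longrightarrow> orbit p i \<noteq> orbit p j)}"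

definition r_derangement_number :: "nat \<Rightarrow> nat \<Rightarrow> nat" where
  "r_derangement_number k r = card (r_derangements k r)"

text \<open>The power series \<open>(1 + \<alpha> t)\<close> to the power \<open>c / \<alpha>\<close>.\<close>

definition fps_one_plus_power :: "'a::field_char_0 \<Rightarrow> 'a \<Rightarrow> 'a fps" where
  "fps_one_plus_power \<alpha> c = Abs_fps (\<lambda>n. factorial_poly c \<alpha> n / fact n)"

definition u_series :: "'a::field_char_0 \<Rightarrow> 'a \<Rightarrow> 'a \<Rightarrow> 'a fps" where
  "u_series x \<alpha> \<beta> = fps_const x * (fps_one_plus_power \<alpha> \<beta> - 1)"

text \<open>The exponential generating function of the numbers
  \<open>\<B>\<close> with parameters \<open>r, x, n, \<lambda>\<close> at \<open>(\<alpha>, \<beta>, \<gamma>)\<close>; here \<open>l\<close> is the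
  parameter \<open>\<lambda>\<close>. The composition and the division are meaningful because
  \<open>u_series\<close> has constant term zero.\<close>

definition B_series ::
    "nat \<Rightarrow> 'a::field_char_0 \<Rightarrow> nat \<Rightarrow> 'a \<Rightarrow> 'a \<Rightarrow> 'a \<Rightarrow> 'a fps" where
  "B_series r x l \<alpha> \<beta> \<gamma> =
     (let u = u_series x \<alpha> \<beta> in
        fps_one_plus_power \<alpha> \<gamma> *
        (u ^ (r * l) * (fps_exp 1 oo (- (of_nat l * u))) / (1 - u) ^ ((r + 1) * l)))"

definition B_number ::
    "nat \<Rightarrow> 'a::field_char_0 \<Rightarrow> nat \<Rightarrow> nat \<Rightarrow> 'a \<Rightarrow> 'a \<Rightarrow> 'a \<Rightarrow> 'a" where
  "B_number r x n l \<alpha> \<beta> \<gamma> = fact n * fps_nth (B_series r x l \<alpha> \<beta> \<gamma>) n"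

text \<open>The description in \<open>gen_stirling\<close> is well-defined
  (\<open>ex1_is_gen_stirling\<close> below).\<close>

lemma u_series_nth_0: "fps_nth (u_series x \<alpha> \<beta>) 0 = 0"
  by (simp add: u_series_def fps_one_plus_power_def factorial_poly_def)

lemma factorial_poly_degree_lead:
  fixes \<beta> \<gamma> :: "'a::field_char_0"
  shows "degree (factorial_poly ([:0, 1:] - [:\<gamma>:]) [:\<beta>:] k) = k \<and>
         lead_coeff (factorial_poly ([:0, 1:] - [:\<gamma>:]) [:\<beta>:] k) = 1"
proof (induction k)
  case 0
  show ?case by (simp add: factorial_poly_def)
next
  case (Suc k)
  let ?q = "factorial_poly ([:0, 1:] - [:\<gamma>:]) [:\<beta>:] k"
  let ?l = "[:- \<gamma> - of_nat k * \<beta>, 1:]"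
  have eq: "factorial_poly ([:0, 1:] - [:\<gamma>:]) [:\<beta>:] (Suc k) = ?q * ?l"
    by (simp add: factorial_poly_def of_nat_poly mult.commute)
  have "?q \<noteq> 0" using Suc.IH by auto
  then have d: "degree (?q * ?l) = Suc k"
    using Suc.IH by (subst degree_mult_eq) auto
  have "lead_coeff (?q * ?l) = lead_coeff ?q * lead_coeff ?l"
    by (rule lead_coeff_mult)
  also have "\<dots> = 1" unfolding conjunct2[OF Suc.IH] by simp
  finally show ?case using d unfolding eq by blast
qed

lemma ex_monic_expansion:
  fixes P :: "nat \<Rightarrow> 'a::field_char_0 poly"
  assumes P: "\<And>k. degree (P k) = k" "\<And>k. lead_coeff (P k) = 1"
  shows "degree p \<le> n \<Longrightarrow> \<exists>s. p = (\<Sum>k\<le>n. smult (s k) (P k))"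
proof (induction n arbitrary: p)
  case 0
  then obtain c where c: "p = [:c:]" by (auto elim: degree_eq_zeroE)
  obtain d where d: "P 0 = [:d:]" using P(1)[of 0] by (auto elim: degree_eq_zeroE)
  with P(2)[of 0] have "P 0 = 1" by simp
  with c show ?case by (intro exI[of _ "\<lambda>_. c"]) simp
next
  case (Suc n)
  define q where "q = p - smult (coeff p (Suc n)) (P (Suc n))"
  have "coeff q i = 0" if "i > n" for i
  proof (cases "i = Suc n")
    case True
    then show ?thesis using P(2)[of "Suc n"] P(1)[of "Suc n"] by (simp add: q_def)
  next
    case False
    then have "i > Suc n" using that by simp
    then show ?thesis using Suc.prems P(1)[of "Suc n"]
      by (simp add: q_def coeff_eq_0)
  qed
  then have "degree q \<le> n" by (intro degree_le) auto
  then obtain s where s: "q = (\<Sum>k\<le>n. smult (s k) (P k))" using Suc.IH by blast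
  have "(\<Sum>k\<le>n. smult ((s(Suc n := coeff p (Suc n))) k) (P k)) =
        (\<Sum>k\<le>n. smult (s k) (P k))"
    by (intro sum.cong) auto
  then show ?case using s
    by (intro exI[of _ "s(Suc n := coeff p (Suc n))"]) (simp add: q_def algebra_simps)
qed

lemma monic_expansion_zero:
  fixes P :: "nat \<Rightarrow> 'a::field_char_0 poly"
  assumes P: "\<And>k. degree (P k) = k" "\<And>k. lead_coeff (P k) = 1"
  shows "(\<Sum>k\<le>n. smult (s k) (P k)) = 0 \<Longrightarrow> k \<le> n \<Longrightarrow> s k = 0"
proof (induction n arbitrary: k)
  case 0
  then show ?case using P(2)[of 0] by auto
next
  case (Suc n)
  have low: "coeff (\<Sum>k\<le>n. smult (s k) (P k)) (Suc n) = 0"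
    by (auto simp: coeff_sum P(1) coeff_eq_0 intro!: sum.neutral)
  have "coeff (\<Sum>k\<le>Suc n. smult (s k) (P k)) (Suc n) = 0"
    using Suc.prems(1) by simp
  with low have top: "s (Suc n) = 0"
    using P(2)[of "Suc n"] P(1)[of "Suc n"] by simp
  then have "(\<Sum>k\<le>n. smult (s k) (P k)) = 0" using Suc.prems(1) by simp
  then show ?case using Suc.IH Suc.prems(2) top by (cases "k = Suc n") auto
qed

lemma ex1_is_gen_stirling: "\<exists>!s. is_gen_stirling n \<alpha> \<beta> \<gamma> s"
proof -
  define P where "P = (\<lambda>k. factorial_poly ([:0, 1:] - [:\<gamma>:]) [:\<beta>:] k)"
  have P: "degree (P k) = k" "lead_coeff (P k) = 1" for k
    using factorial_poly_degree_lead[of \<gamma> \<beta> k] unfolding P_def by blast+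
  have "degree (factorial_poly [:0, 1:] [:\<alpha>:] n) \<le> n"
    using factorial_poly_degree_lead[of 0 \<alpha> n] by simp
  from ex_monic_expansion[of P, OF P this]
  obtain s where s: "factorial_poly [:0, 1:] [:\<alpha>:] n = (\<Sum>k\<le>n. smult (s k) (P k))"
    by blast
  show ?thesis
  proof (rule ex1I[of _ "\<lambda>k. if k \<le> n then s k else 0"])
    show "is_gen_stirling n \<alpha> \<beta> \<gamma> (\<lambda>k. if k \<le> n then s k else 0)"
      using s by (simp add: is_gen_stirling_def P_def)
  next
    fix s' assume s': "is_gen_stirling n \<alpha> \<beta> \<gamma> s'"
    then have "(\<Sum>k\<le>n. smult (s' k - s k) (P k)) = 0"
      using s by (simp add: is_gen_stirling_def P_def smult_diff_left sum_subtractf)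
    from monic_expansion_zero[of P, OF P this] s'
    show "s' = (\<lambda>k. if k \<le> n then s k else 0)"
      by (fastforce simp: is_gen_stirling_def)
  qed
qed

lemma is_gen_stirling_gen_stirling:
  "is_gen_stirling n \<alpha> \<beta> \<gamma> (\<lambda>k. gen_stirling n k \<alpha> \<beta> \<gamma>)"
  unfolding gen_stirling_def by (rule theI'[OF ex1_is_gen_stirling])

end

theory Submission
  imports Defs
begin

text \<open>Let \<open>H\<^sub>c\<close> denote \<open>(1 + \<alpha> t)\<close> to the power \<open>c / \<alpha>\<close>, so that \<open>H\<close> turns addition of multiples
  of \<open>\<alpha>\<close> into multiplication. Evaluating the defining identity of the generalized Stirling
  numbers at \<open>\<gamma> + m \<beta>\<close> and inverting the resulting binomial sums in \<open>m\<close> identifies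
  \<open>k! \<beta>\<^sup>k S(n, k, \<alpha>, \<beta>, \<gamma>)\<close> with the \<open>n\<close>-th exponential coefficient of
  \<open>H\<^sub>\<gamma> (H\<^sub>\<beta> - 1)\<^sup>k\<close>. Composing the exponential generating function of the \<open>r\<close>-derangement
  numbers with \<open>x (H\<^sub>\<beta> - 1)\<close> then gives the theorem. That generating function in turn is
  characterized by a first-order differential equation, which is the combinatorial recurrence
  obtained by removing an element from its cycle.\<close>

section \<open>Counting derangements with marked elements in distinct cycles\<close>

text \<open>Arbitrary finite sets replace the initial segments of the problem, because the
  recurrence deletes elements from anywhere.\<close>

definition marked_derangements :: "'a set \<Rightarrow> 'a set \<Rightarrow> ('a \<Rightarrow> 'a) set" where
  "marked_derangements A R =
     {p. p permutes A \<and> (\<forall>i\<in>A. p i \<noteq> i) \<and> inj_on (orbit p) R}"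

lemma r_derangements_eq_marked:
  "r_derangements k r = marked_derangements {1..k + r} {1..r}"
  unfolding r_derangements_def marked_derangements_def inj_on_def by blast

lemma finite_marked_derangements: "finite A \<Longrightarrow> finite (marked_derangements A R)"
  unfolding marked_derangements_def
  by (rule finite_subset[OF _ finite_permutations[of A]]) auto

lemma orbit_eq_iff_in_orbit:
  assumes "p permutes A" "finite A"
  shows "orbit p x = orbit p y \<longleftrightarrow> x \<in> orbit p y"
proof -
  have "permutation p" using assms by (auto simp: permutation_permutes)
  then have self: "z \<in> orbit p z" for z by (rule permutation_self_in_orbit)
  show ?thesis
    by (metis self orbit_swap orbit_subset subset_antisym orbit_trans subsetI)
qed

text \<open>Composing with \<open>transpose m j\<close> inserts \<open>m\<close> into the cycle of
  \<open>j\<close> immediately before \<open>j\<close>: the preimage of \<open>j\<close> now maps to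
  \<open>m\<close>, and \<open>m\<close> to \<open>j\<close>. All other arrows are
  unchanged.\<close>

lemma orbit_insert_transpose:
  assumes q: "q permutes B" and m: "m \<notin> B" and j: "j \<in> B" and i: "i \<in> B"
  shows "orbit (transpose m j \<circ> q) i - {m} = orbit q i"
proof -
  define p where "p = transpose m j \<circ> q"
  have qB: "q y \<in> B" if "y \<in> B" for y using q that by (simp add: permutes_in_image)
  have pm: "p m = j" using q m by (simp add: p_def permutes_not_in)
  have px: "p y = (if q y = j then m else q y)" if "y \<in> B" for y
    using qB[OF that] m j by (auto simp: p_def transpose_def)
  have 1: "y \<in> B \<and> y \<in> orbit p i" if "y \<in> orbit q i" for y
    using that
  proof induction
    case base
    have "q i \<in> orbit p i"
      using px[OF i] pm orbit.base[of p i] orbit.step[of m p i] by (cases "q i = j") auto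
    then show ?case using qB i by simp
  next
    case (step y)
    then have "q y \<in> orbit p i"
      using px[of y] pm orbit.step[of y p i] orbit.step[of m p i] by (cases "q y = j") auto
    then show ?case using qB step by simp
  qed
  \<comment> \<open>The orbit can reach \<open>m\<close> only from a point that \<open>q\<close>
    sends to \<open>j\<close>, so at \<open>m\<close> the invariant records \<open>j\<close>
    instead.\<close>
  have 2: "if y = m then j \<in> orbit q i else y \<in> B \<and> y \<in> orbit q i" if "y \<in> orbit p i" for y
    using that
  proof induction
    case base
    show ?case using px[OF i] orbit.base[of q i] qB[OF i] m by (auto split: if_splits)
  next
    case (step y)
    show ?case
    proof (cases "y = m")
      case True
      then show ?thesis using step pm j m by auto
    next
      case False
      then have y: "y \<in> B" "y \<in> orbit q i" using step by auto
      show ?thesis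
        using px[OF y(1)] orbit.step[OF y(2)] qB[OF y(1)] m by (auto split: if_splits)
    qed
  qed
  have "y \<in> orbit q i" if "y \<in> orbit p i" "y \<noteq> m" for y
    using 2[OF that(1)] that(2) by simp
  then show ?thesis unfolding p_def[symmetric] using 1 m by blast
qed

lemma inj_on_orbit_insert_transpose:
  assumes q: "q permutes B" and fin: "finite B" and m: "m \<notin> B" and j: "j \<in> B" and R: "R \<subseteq> B"
  shows "inj_on (orbit (transpose m j \<circ> q)) R \<longleftrightarrow> inj_on (orbit q) R"
proof -
  let ?p = "transpose m j \<circ> q"
  have p: "?p permutes insert m B"
    using q j by (intro permutes_compose permutes_swap_id permutes_imp_permutes_insert) auto
  have "orbit ?p a = orbit ?p b \<longleftrightarrow> orbit q a = orbit q b" if "a \<in> R" "b \<in> R" for a b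
  proof -
    have "a \<in> orbit ?p b \<longleftrightarrow> a \<in> orbit q b"
      using orbit_insert_transpose[OF q m j, of b] that R m by auto
    then show ?thesis
      using orbit_eq_iff_in_orbit[OF p] orbit_eq_iff_in_orbit[OF q] fin by simp
  qed
  then show ?thesis by (auto simp: inj_on_def)
qed

text \<open>Inserting \<open>m\<close> before \<open>j\<close> creates no fixed point and removes at
  most the fixed point \<open>j\<close>. Hence \<open>q\<close> is either fixed-point free on
  \<open>B\<close> or has \<open>j\<close> as its only fixed point there.\<close>

lemma insert_transpose_in_marked_derangements_iff:
  assumes q: "q permutes B" and fin: "finite B" and m: "m \<notin> B" and j: "j \<in> B" and R: "R \<subseteq> B"
  shows "transpose m j \<circ> q \<in> marked_derangements (insert m B) R \<longleftrightarrow>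
    q \<in> marked_derangements B R \<or> q \<in> marked_derangements (B - {j}) (R - {j})"
proof -
  let ?p = "transpose m j \<circ> q"
  have p: "?p permutes insert m B"
    using q j by (intro permutes_compose permutes_swap_id permutes_imp_permutes_insert) auto
  have pm: "?p m \<noteq> m" using q m j by (auto simp: permutes_not_in)
  have px: "?p i = i \<longleftrightarrow> q i = i \<and> i \<noteq> j" if "i \<in> B" for i
  proof -
    have "q i \<in> B" using q that by (simp add: permutes_in_image)
    then show ?thesis using that m j by (auto simp: transpose_def)
  qed
  have "?p \<in> marked_derangements (insert m B) R \<longleftrightarrow>
      (\<forall>i\<in>B. q i = i \<longrightarrow> i = j) \<and> inj_on (orbit q) R"
    using p pm px inj_on_orbit_insert_transpose[OF assms]
    by (auto simp: marked_derangements_def simp del: o_apply)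
  also have "\<dots> \<longleftrightarrow> q \<in> marked_derangements B R \<or> q \<in> marked_derangements (B - {j}) (R - {j})"
  proof (cases "q j = j")
    case False
    then have "\<not> q permutes (B - {j})" by (metis Diff_iff insertI1 permutes_not_in)
    with False show ?thesis using q by (auto simp: marked_derangements_def)
  next
    case True
    have perm: "q permutes (B - {j})"
      by (rule permutes_superset[OF q]) (use True in auto)
    have "orbit q j = {j}" using True by (simp add: orbit_eq_singleton_iff)
    moreover have "a \<in> orbit q a" for a
      using q fin by (intro permutation_self_in_orbit) (auto simp: permutation_permutes)
    ultimately have "orbit q a \<noteq> orbit q j" if "a \<noteq> j" for a using that by blast
    then have "inj_on (orbit q) R \<longleftrightarrow> inj_on (orbit q) (R - {j})"
      unfolding inj_on_def by (metis Diff_iff singletonD)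
    with perm True q j show ?thesis by (auto simp: marked_derangements_def)
  qed
  finally show ?thesis .
qed

text \<open>Delete \<open>m\<close> from its cycle. Either no fixed point arises, or \<open>m\<close> formed a 2-cycle with
  some \<open>j\<close>, which is then deleted as well.\<close>

lemma card_marked_derangements_insert:
  assumes fin: "finite B" and m: "m \<notin> B" and R: "R \<subseteq> B"
  shows "card (marked_derangements (insert m B) R) =
    card B * card (marked_derangements B R) +
    (\<Sum>j\<in>B. card (marked_derangements (B - {j}) (R - {j})))"
proof -
  define f where "f = (\<lambda>(j, q). transpose m j \<circ> (q :: 'a \<Rightarrow> 'a))"
  define S1 where "S1 = B \<times> marked_derangements B R"
  define S2 where "S2 = (SIGMA j:B. marked_derangements (B - {j}) (R - {j}))"
  have S: "j \<in> B \<and> q permutes B" if "(j, q) \<in> S1 \<union> S2" for j q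
    using that permutes_subset[of q "B - {j}" B]
    by (auto simp: S1_def S2_def marked_derangements_def)
  have "f ` (S1 \<union> S2) = marked_derangements (insert m B) R"
  proof
    show "f ` (S1 \<union> S2) \<subseteq> marked_derangements (insert m B) R"
    proof
      fix p assume "p \<in> f ` (S1 \<union> S2)"
      then obtain j q where jq: "(j, q) \<in> S1 \<union> S2" "p = transpose m j \<circ> q"
        by (auto simp: f_def)
      then show "p \<in> marked_derangements (insert m B) R"
        using S[OF jq(1)] insert_transpose_in_marked_derangements_iff[OF _ fin m _ R, of q j]
        by (auto simp: S1_def S2_def)
    qed
  next
    show "marked_derangements (insert m B) R \<subseteq> f ` (S1 \<union> S2)"
    proof
      fix p assume p: "p \<in> marked_derangements (insert m B) R"
      then have pp: "p permutes insert m B" "p m \<noteq> m" by (auto simp: marked_derangements_def)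
      \<comment> \<open>Inverse of \<open>f\<close>: the image of \<open>m\<close> recovers
        \<open>j\<close>, and cancelling the transposition recovers \<open>q\<close>.\<close>
      define j q where "j = p m" and "q = transpose m j \<circ> p"
      have j: "j \<in> B" using pp permutes_in_image[OF pp(1), of m] by (auto simp: j_def)
      have q: "q permutes B" using permutes_insert_lemma[OF pp(1)] by (simp add: q_def j_def)
      have pq: "p = transpose m j \<circ> q" by (simp add: q_def fun_eq_iff)
      then have "(j, q) \<in> S1 \<union> S2"
        using insert_transpose_in_marked_derangements_iff[OF q fin m j R] p j
        by (auto simp: S1_def S2_def)
      then show "p \<in> f ` (S1 \<union> S2)" by (rule rev_image_eqI) (simp add: f_def pq)
    qed
  qed
  moreover have "inj_on f (S1 \<union> S2)"
  proof (rule inj_onI, clarify)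
    fix j q j' q'
    assume a: "(j, q) \<in> S1 \<union> S2" "(j', q') \<in> S1 \<union> S2" "f (j, q) = f (j', q')"
    have "q m = m" "q' m = m" using S[OF a(1)] S[OF a(2)] m by (auto simp: permutes_not_in)
    then have "j = j'" using fun_cong[OF a(3), of m] by (simp add: f_def)
    moreover have "transpose m j \<circ> f (j, q) = q" "transpose m j' \<circ> f (j', q') = q'"
      by (auto simp: f_def fun_eq_iff)
    ultimately show "j = j' \<and> q = q'" using a(3) by metis
  qed
  ultimately have "card (marked_derangements (insert m B) R) = card (S1 \<union> S2)"
    by (metis card_image)
  also have "\<dots> = card S1 + card S2"
  proof (rule card_Un_disjoint)
    show "finite S1" "finite S2"
      using fin by (auto simp: S1_def S2_def finite_marked_derangements)
    show "S1 \<inter> S2 = {}"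
    proof (rule ccontr)
      assume "S1 \<inter> S2 \<noteq> {}"
      then obtain j q where "j \<in> B" "q \<in> marked_derangements B R"
        "q \<in> marked_derangements (B - {j}) (R - {j})"
        by (auto simp: S1_def S2_def)
      \<comment> \<open>\<open>q\<close> moves \<open>j\<close> in the first case and fixes it in
        the second.\<close>
      then show False
        by (auto simp: marked_derangements_def permutes_not_in)
    qed
  qed
  finally show ?thesis
    using fin by (simp add: S1_def S2_def card_cartesian_product finite_marked_derangements)
qed

text \<open>If everything is marked, \<open>i\<close> and \<open>p i\<close> would be two distinct
  marked elements of one cycle. Only the empty permutation remains.\<close>

lemma card_marked_derangements_all:
  assumes "finite R"
  shows "card (marked_derangements R R) = (if R = {} then 1 else 0)"
proof (cases "R = {}")
  case True
  then show ?thesis by (simp add: marked_derangements_def)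
next
  case False
  have False if "p \<in> marked_derangements R R" for p
  proof -
    from False obtain i where i: "i \<in> R" by blast
    have p: "p permutes R" "p i \<noteq> i" "inj_on (orbit p) R"
      using that i by (auto simp: marked_derangements_def)
    have "p i \<in> R" using p i by (simp add: permutes_in_image)
    moreover have "orbit p (p i) = orbit p i"
      using orbit_eq_iff_in_orbit[OF p(1) assms] orbit.base by metis
    ultimately show False using p i by (auto dest: inj_onD)
  qed
  then have "marked_derangements R R = {}" by blast
  with False show ?thesis by simp
qed

section \<open>The exponential generating function\<close>

definition r_derangement_egf :: "nat \<Rightarrow> 'a::field_char_0 fps" where
  "r_derangement_egf r = fps_X ^ r * fps_exp (- 1) / (1 - fps_X) ^ Suc r"

text \<open>The shape is chosen so that comparing coefficients yields the recurrence of the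
  cardinalities. For \<open>r = 0\<close> the truncated \<open>r - 1\<close> is harmless, its term
  having the factor \<open>r\<close>.\<close>

lemma r_derangement_egf_deriv:
  "(1 - fps_X) * fps_deriv (r_derangement_egf r :: 'a::field_char_0 fps) =
     of_nat r * r_derangement_egf (r - 1) + (fps_X + of_nat r) * r_derangement_egf r"
proof -
  define J where "J = inverse (1 - fps_X :: 'a fps)"
  define E where "E = fps_exp (- 1 :: 'a)"
  have J1: "(1 - fps_X) * J = 1"
    unfolding J_def by (rule inverse_mult_eq_1') simp
  have dJ: "fps_deriv J = J ^ 2"
    unfolding J_def by (subst fps_inverse_deriv) simp_all
  have dE: "fps_deriv E = - E"
    by (simp add: E_def flip: fps_const_neg)
  have G: "r_derangement_egf s = fps_X ^ s * E * J ^ Suc s" for s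
    unfolding r_derangement_egf_def E_def J_def
    by (subst fps_divide_unit) (simp_all add: fps_inverse_power del: power_Suc)
  show ?thesis
  proof (cases r)
    case 0
    have "(1 - fps_X) * (J * (E * J)) = E * J" using J1 by (metis mult.assoc mult_1)
    moreover have "(1 - fps_X) * (E * J) = E" using J1 by (metis mult.left_commute mult.right_neutral)
    ultimately show ?thesis
      unfolding G 0 by (simp add: dE dJ power2_eq_square) (use J1 in algebra)
  next
    case (Suc s)
    have dX: "fps_deriv (fps_X ^ r :: 'a fps) = of_nat r * fps_X ^ s"
      by (subst fps_deriv_power') (simp add: Suc)
    have dJr: "fps_deriv (J ^ Suc r) = of_nat (Suc r) * J ^ Suc (Suc r)"
      by (subst fps_deriv_power') (simp add: dJ power2_eq_square mult.assoc del: of_nat_Suc)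
    \<comment> \<open>The derivative given by the product rule, with one factor \<open>J\<close>
      taken out.\<close>
    define W where "W = of_nat r * fps_X ^ s * E * J ^ r - fps_X ^ r * E * J ^ r +
        of_nat (Suc r) * fps_X ^ r * E * J ^ Suc r"
    have "(1 - fps_X) * fps_deriv (r_derangement_egf r) = ((1 - fps_X) * J) * W"
      unfolding G fps_deriv_mult dX dE dJr W_def by (simp add: algebra_simps del: of_nat_Suc)
    also have "W = of_nat r * (fps_X ^ s * E * J ^ Suc s) +
        (fps_X + of_nat r) * (fps_X ^ r * E * J ^ Suc r) +
        fps_X ^ r * E * J ^ r * ((1 - fps_X) * J - 1)"
      unfolding W_def by (simp add: Suc algebra_simps)
    finally show ?thesis
      unfolding G J1 by (simp add: Suc)
  qed
qed

text \<open>The terms match the insertion recurrence with \<open>k\<close> unmarked and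
  \<open>r\<close> marked elements besides \<open>m\<close>: insertion into a derangement, a 2-cycle
  with a marked element, a 2-cycle with an unmarked one.\<close>

lemma r_derangement_egf_nth_Suc:
  fixes r k :: nat
  defines "g \<equiv> \<lambda>s. fps_nth (r_derangement_egf s :: 'a::field_char_0 fps)"
  shows "fact (Suc k) * g r (Suc k) =
    of_nat (k + r) * (fact k * g r k) + of_nat r * (fact k * g (r - 1) k) +
    of_nat k * (fact (k - 1) * g r (k - 1))"
proof -
  have "fps_nth ((1 - fps_X) * fps_deriv (r_derangement_egf r :: 'a fps)) k =
      of_nat (Suc k) * g r (Suc k) - of_nat k * g r k"
    by (cases k) (simp_all add: g_def left_diff_distrib del: of_nat_Suc)
  moreover have "fps_nth ((1 - fps_X) * fps_deriv (r_derangement_egf r :: 'a fps)) k =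
      of_nat r * g (r - 1) k + (if k = 0 then 0 else g r (k - 1)) + of_nat r * g r k"
    unfolding r_derangement_egf_deriv
    by (simp add: g_def distrib_right)
  ultimately have "of_nat (Suc k) * g r (Suc k) - of_nat k * g r k =
      of_nat r * g (r - 1) k + (if k = 0 then 0 else g r (k - 1)) + of_nat r * g r k"
    by metis
  then have eq: "of_nat (Suc k) * g r (Suc k) =
      of_nat r * g (r - 1) k + (if k = 0 then 0 else g r (k - 1)) + of_nat r * g r k + of_nat k * g r k"
    by (simp only: diff_eq_eq)
  have "fact (Suc k) * g r (Suc k) = fact k * (of_nat (Suc k) * g r (Suc k))"
    by (simp add: algebra_simps)
  also have "\<dots> = of_nat (k + r) * (fact k * g r k) + of_nat r * (fact k * g (r - 1) k) +
      of_nat k * (fact (k - 1) * g r (k - 1))"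
    unfolding eq by (cases k) (simp_all add: algebra_simps)
  finally show ?thesis .
qed

text \<open>Induction on the number of unmarked elements, always removing an unmarked
  \<open>m\<close>. Deleting a marked partner of \<open>m\<close> lowers the number of marks
  instead, so the induction must range over all \<open>R\<close>.\<close>

lemma card_marked_derangements:
  assumes "finite A" "R \<subseteq> A"
  shows "of_nat (card (marked_derangements A R)) =
    fact (card (A - R)) * fps_nth (r_derangement_egf (card R) :: 'a::field_char_0 fps) (card (A - R))"
  using assms
proof (induction "card (A - R)" arbitrary: A R rule: less_induct)
  case less
  let ?g = "\<lambda>s. fps_nth (r_derangement_egf s :: 'a fps)"
  have finR: "finite R" using less.prems finite_subset by blast
  show ?case
  proof (cases "A - R = {}")
    case True
    then have "A = R" using less.prems by blast
    then show ?thesis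
      using card_marked_derangements_all[OF finR] finR
      by (simp add: r_derangement_egf_def fps_divide_unit)
  next
    case False
    then obtain m where m: "m \<in> A" "m \<notin> R" by blast
    define B where "B = A - {m}"
    define k where "k = card (B - R)"
    have B: "finite B" "m \<notin> B" "R \<subseteq> B" "A = insert m B"
      using less.prems m by (auto simp: B_def)
    have AR: "A - R = insert m (B - R)" using B m by auto
    have k: "card (A - R) = Suc k" unfolding AR k_def using B by simp
    have cB: "card B = k + card R"
      using card_Diff_subset[OF finR B(3)] card_mono[OF B(1,3)] by (simp add: k_def)
    have IH: "of_nat (card (marked_derangements C S)) = fact (card (C - S)) * ?g (card S) (card (C - S))"
      if "card (C - S) \<le> k" "S \<subseteq> C" "C \<subseteq> B" for C S
      using that less.hyps[of C S] k B(1) finite_subset by auto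
    have sR: "of_nat (card (marked_derangements (B - {j}) (R - {j}))) = fact k * ?g (card R - 1) k"
      if "j \<in> R" for j
    proof -
      have "B - {j} - (R - {j}) = B - R" using that by auto
      then show ?thesis using IH[of "B - {j}" "R - {j}"] that B(3) finR by (auto simp: k_def)
    qed
    have sB: "of_nat (card (marked_derangements (B - {j}) (R - {j}))) =
        fact (k - 1) * ?g (card R) (k - 1)"
      if "j \<in> B - R" for j
    proof -
      have "R - {j} = R" "B - {j} - R = B - R - {j}" using that by auto
      moreover have "card (B - R - {j}) = k - 1" using that B(1) by (simp add: k_def)
      ultimately show ?thesis using IH[of "B - {j}" R] that B(3) by auto
    qed
    let ?c = "\<lambda>j. of_nat (card (marked_derangements (B - {j}) (R - {j}))) :: 'a"
    have "sum ?c B = sum ?c (B - R) + sum ?c R"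
      by (rule sum.subset_diff[OF B(3,1)])
    also have "sum ?c (B - R) = (\<Sum>j\<in>B - R. fact (k - 1) * ?g (card R) (k - 1))"
      by (rule sum.cong[OF refl sB])
    also have "\<dots> = of_nat k * (fact (k - 1) * ?g (card R) (k - 1))"
      by (simp add: k_def)
    also have "sum ?c R = of_nat (card R) * (fact k * ?g (card R - 1) k)"
      using sR by simp
    finally have "of_nat (card (marked_derangements A R)) = fact (Suc k) * ?g (card R) (Suc k)"
      unfolding r_derangement_egf_nth_Suc B(4) card_marked_derangements_insert[OF B(1-3)]
      using IH[of B R] B(3) by (simp add: cB k_def)
    then show ?thesis by (simp add: k)
  qed
qed

lemma r_derangement_number_eq:
  "of_nat (r_derangement_number k r) =
     fact k * fps_nth (r_derangement_egf r :: 'a::field_char_0 fps) k"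
proof -
  have "{1..k + r} - {1..r} = {r + 1..k + r}" by auto
  then have "card ({1..k + r} - {1..r}) = k" by simp
  then show ?thesis
    using card_marked_derangements[of "{1..k + r}" "{1..r}", where 'a = 'a]
    by (simp add: r_derangement_number_def r_derangements_eq_marked)
qed

section \<open>Generalized Stirling numbers\<close>

lemma factorial_poly_Suc:
  "factorial_poly t \<alpha> (Suc n) = factorial_poly t \<alpha> n * (t - of_nat n * \<alpha>)"
  by (simp add: factorial_poly_def)

text \<open>Both products of length \<open>Suc n\<close> contain
  \<open>factorial_poly t \<alpha> n\<close>; the remaining factors \<open>t + \<alpha>\<close> and
  \<open>t - of_nat n * \<alpha>\<close> differ by \<open>of_nat (Suc n) * \<alpha>\<close>.\<close>

lemma factorial_poly_add_Suc:
  "factorial_poly (t + \<alpha>) \<alpha> (Suc n) =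
     factorial_poly t \<alpha> (Suc n) + of_nat (Suc n) * \<alpha> * factorial_poly t \<alpha> n"
proof (induction n)
  case 0
  then show ?case by (simp add: factorial_poly_def)
next
  case (Suc n)
  have "factorial_poly (t + \<alpha>) \<alpha> (Suc (Suc n)) =
      (factorial_poly t \<alpha> (Suc n) + of_nat (Suc n) * \<alpha> * factorial_poly t \<alpha> n) *
      (t - of_nat n * \<alpha>)"
    unfolding factorial_poly_Suc[of "t + \<alpha>" \<alpha> "Suc n"] Suc.IH by (simp add: algebra_simps)
  then show ?case
    unfolding factorial_poly_Suc[of t] by (simp add: algebra_simps)
qed

text \<open>Divisibility enters here: an integral exponent makes the formal power a genuine one,
  since raising the parameter by \<alpha> multiplies the series by 1 + \<alpha> t.\<close>

lemma fps_one_plus_power_of_nat_mult: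
  "fps_one_plus_power \<alpha> (of_nat b * \<alpha>) = (1 + fps_const \<alpha> * fps_X) ^ b"
proof (induction b)
  case 0
  have "factorial_poly 0 \<alpha> n = (if n = 0 then 1 else 0)" for n
    by (cases n) (auto simp: factorial_poly_def intro!: prod_zero)
  then show ?case by (simp add: fps_eq_iff fps_one_plus_power_def)
next
  case (Suc b)
  have "fps_one_plus_power \<alpha> (t + \<alpha>) =
      fps_one_plus_power \<alpha> t * (1 + fps_const \<alpha> * fps_X)" for t :: 'a
  proof (rule fps_ext)
    fix n
    show "fps_nth (fps_one_plus_power \<alpha> (t + \<alpha>)) n =
        fps_nth (fps_one_plus_power \<alpha> t * (1 + fps_const \<alpha> * fps_X)) n"
    proof (cases n)
      case 0
      then show ?thesis by (simp add: fps_one_plus_power_def factorial_poly_def)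
    next
      case (Suc k)
      have "fps_nth (fps_one_plus_power \<alpha> t * (1 + fps_const \<alpha> * fps_X)) n =
          factorial_poly t \<alpha> (Suc k) / fact (Suc k) + \<alpha> * (factorial_poly t \<alpha> k / fact k)"
        by (simp add: Suc fps_one_plus_power_def distrib_left mult.left_commute[of _ "fps_const \<alpha>"]
            del: fact_Suc)
      then show ?thesis
        by (simp add: Suc fps_one_plus_power_def factorial_poly_add_Suc add_divide_distrib
            del: of_nat_Suc)
    qed
  qed
  from this[of "of_nat b * \<alpha>"] Suc.IH show ?case
    by (simp add: algebra_simps)
qed

lemma factorial_poly_multiple:
  "factorial_poly (of_nat m * \<beta>) \<beta> k = \<beta> ^ k * fact k * of_nat (m choose k)"
  for \<beta> :: "'a::field_char_0"
proof -
  have "factorial_poly (of_nat m * \<beta>) \<beta> k = (\<Prod>j<k. \<beta> * (of_nat m - of_nat j))"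
    unfolding factorial_poly_def by (intro prod.cong) (simp_all add: algebra_simps)
  also have "\<dots> = \<beta> ^ k * (\<Prod>j = 0..<k. of_nat m - of_nat j)"
    by (simp add: prod.distrib lessThan_atLeast0)
  finally show ?thesis
    by (simp add: binomial_gbinomial gbinomial_mult_fact mult.assoc)
qed

lemma poly_factorial_poly:
  "poly (factorial_poly p q n) z = factorial_poly (poly p z) (poly q z) n"
  by (simp add: factorial_poly_def poly_prod of_nat_poly)

lemma factorial_poly_gen_stirling:
  "factorial_poly t \<alpha> n =
     (\<Sum>k\<le>n. gen_stirling n k \<alpha> \<beta> \<gamma> * factorial_poly (t - \<gamma>) \<beta> k)"
proof -
  have "factorial_poly [:0, 1:] [:\<alpha>:] n = (\<Sum>k\<le>n. smult (gen_stirling n k \<alpha> \<beta> \<gamma>)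
      (factorial_poly ([:0, 1:] - [:\<gamma>:]) [:\<beta>:] k))"
    using is_gen_stirling_gen_stirling[of n \<alpha> \<beta> \<gamma>] unfolding is_gen_stirling_def by blast
  from arg_cong[OF this, of "\<lambda>p. poly p t"] show ?thesis
    by (simp add: poly_factorial_poly poly_sum)
qed

lemma gen_stirling_eq_0: "n < k \<Longrightarrow> gen_stirling n k \<alpha> \<beta> \<gamma> = 0"
  using is_gen_stirling_gen_stirling[of n \<alpha> \<beta> \<gamma>] unfolding is_gen_stirling_def by blast

text \<open>The system is triangular with diagonal entries \<open>k choose k = 1\<close>.\<close>

lemma binomial_sums_unique:
  fixes a b :: "nat \<Rightarrow> 'a::field_char_0"
  assumes "\<And>m. (\<Sum>k\<le>m. of_nat (m choose k) * a k) = (\<Sum>k\<le>m. of_nat (m choose k) * b k)"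
  shows "a k = b k"
proof (induction k rule: less_induct)
  case (less k)
  then have "(\<Sum>i<k. of_nat (k choose i) * a i) = (\<Sum>i<k. of_nat (k choose i) * b i)"
    by (intro sum.cong) auto
  with assms[of k] show ?case by (simp add: lessThan_Suc_atMost[symmetric])
qed

text \<open>Both sides are the coefficients of \<open>(\<gamma> + m \<beta> | \<alpha>)\<^sub>n\<close> in the basis of binomial coefficients
  \<open>m choose k\<close>.\<close>

lemma gen_stirling_egf:
  fixes \<alpha> \<beta> \<gamma> :: "'a::field_char_0" and b c :: nat
  assumes \<beta>: "\<beta> = of_nat b * \<alpha>" and \<gamma>: "\<gamma> = of_nat c * \<alpha>"
  shows "fact k * \<beta> ^ k * gen_stirling n k \<alpha> \<beta> \<gamma> =
    fact n * fps_nth (fps_one_plus_power \<alpha> \<gamma> * (fps_one_plus_power \<alpha> \<beta> - 1) ^ k) n"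
proof (rule binomial_sums_unique[where k = k and
      a = "\<lambda>k. fact k * \<beta> ^ k * gen_stirling n k \<alpha> \<beta> \<gamma>" and
      b = "\<lambda>k. fact n * fps_nth (fps_one_plus_power \<alpha> \<gamma> * (fps_one_plus_power \<alpha> \<beta> - 1) ^ k) n"])
  fix m
  let ?H = "fps_one_plus_power \<alpha>"
  let ?s = "\<lambda>k. gen_stirling n k \<alpha> \<beta> \<gamma>"
  have t: "of_nat m * \<beta> + \<gamma> = of_nat (b * m + c) * \<alpha>"
    by (simp add: \<beta> \<gamma> algebra_simps)
  \<comment> \<open>The range of summation passes from \<open>m\<close> to \<open>n\<close> through
    their maximum: binomials vanish for \<open>k > m\<close>, Stirling numbers for
    \<open>k > n\<close>.\<close>
  have "(\<Sum>k\<le>m. of_nat (m choose k) * (fact k * \<beta> ^ k * ?s k)) =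
      (\<Sum>k\<le>max m n. of_nat (m choose k) * (fact k * \<beta> ^ k * ?s k))"
    by (rule sum.mono_neutral_left) auto
  also have "\<dots> = (\<Sum>k\<le>n. of_nat (m choose k) * (fact k * \<beta> ^ k * ?s k))"
    by (rule sum.mono_neutral_right) (auto simp: gen_stirling_eq_0)
  also have "\<dots> = factorial_poly (of_nat m * \<beta> + \<gamma>) \<alpha> n"
    by (subst factorial_poly_gen_stirling[of _ \<alpha> n \<beta> \<gamma>])
       (simp add: factorial_poly_multiple, simp add: mult_ac)
  also have "\<dots> = fact n * fps_nth (?H (of_nat m * \<beta> + \<gamma>)) n"
    by (simp add: fps_one_plus_power_def)
  also have "?H (of_nat m * \<beta> + \<gamma>) = ?H \<gamma> * ?H \<beta> ^ m"
    unfolding t unfolding \<beta> \<gamma> fps_one_plus_power_of_nat_mult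
    by (simp add: power_add power_mult)
  \<comment> \<open>Binomial theorem for \<open>(?H \<beta> - 1) + 1\<close>.\<close>
  also have "?H \<beta> ^ m = (\<Sum>k\<le>m. of_nat (m choose k) * (?H \<beta> - 1) ^ k)"
    using binomial_ring[of "?H \<beta> - 1" 1 m] by simp
  also have "fact n * fps_nth (?H \<gamma> * (\<Sum>k\<le>m. of_nat (m choose k) * (?H \<beta> - 1) ^ k)) n =
      (\<Sum>k\<le>m. of_nat (m choose k) * (fact n * fps_nth (?H \<gamma> * (?H \<beta> - 1) ^ k) n))"
    by (simp add: sum_distrib_left fps_sum_nth mult.left_commute[of _ "of_nat _"])
  finally show "(\<Sum>k\<le>m. of_nat (m choose k) * (fact k * \<beta> ^ k * ?s k)) = \<dots>" .
qed

section \<open>Composition\<close>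

lemma r_derangement_egf_compose:
  fixes u :: "'a::field_char_0 fps"
  assumes u: "fps_nth u 0 = 0"
  shows "r_derangement_egf r oo u = u ^ r * (fps_exp 1 oo - u) / (1 - u) ^ Suc r"
proof -
  \<comment> \<open>The exponential is rewritten into the form used in \<open>B_series\<close>, with
    the sign moved into the inner series.\<close>
  have "fps_exp (- 1) oo u = fps_exp 1 oo - fps_X oo u" by simp
  also have "\<dots> = fps_exp 1 oo (- fps_X oo u)"
    by (rule fps_compose_assoc[symmetric]) (use u in auto)
  also have "- fps_X oo u = - u"
    using u by (simp add: fps_compose_uminus)
  finally have e: "fps_exp (- 1) oo u = fps_exp 1 oo - u" .
  show ?thesis
    unfolding r_derangement_egf_def
    using u by (simp add: fps_divide_compose fps_compose_mult_distrib e
        fps_compose_sub_distrib flip: fps_compose_power del: power_Suc)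
qed

lemma fps_nth_mult_compose:
  fixes f g u :: "'a::field fps"
  assumes u: "fps_nth u 0 = 0"
  shows "fps_nth (g * (f oo u)) n = (\<Sum>k\<le>n. fps_nth f k * fps_nth (g * u ^ k) n)"
proof -
  \<comment> \<open>\<open>u ^ k\<close> has no terms below degree \<open>k\<close>, so the bound
    \<open>n\<close> serves for every \<open>j\<close> and the two sums can be swapped.\<close>
  have "fps_nth (f oo u) j = (\<Sum>k\<le>n. fps_nth f k * fps_nth (u ^ k) j)" if "j \<le> n" for j
    unfolding fps_compose_nth
    by (rule sum.mono_neutral_left) (use that startsby_zero_power_prefix[OF u] in auto)
  then have "fps_nth (g * (f oo u)) n =
      (\<Sum>i = 0..n. \<Sum>k\<le>n. fps_nth f k * (fps_nth g i * fps_nth (u ^ k) (n - i)))"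
    by (simp add: fps_mult_nth sum_distrib_left mult.left_commute)
  also have "\<dots> = (\<Sum>k\<le>n. fps_nth f k * fps_nth (g * u ^ k) n)"
    by (subst sum.swap) (simp add: fps_mult_nth sum_distrib_left)
  finally show ?thesis .
qed

theorem theorem2p1:
  fixes x :: "'a::field_char_0" and \<alpha> \<beta> \<gamma> r n :: nat
  assumes "\<alpha> > 0" and "\<alpha> dvd \<beta>" and "\<alpha> dvd \<gamma>"
  shows "B_number r x n 1 (of_nat \<alpha>) (of_nat \<beta>) (of_nat \<gamma>) =
    (\<Sum>k\<le>n. of_nat (r_derangement_number k r) * x ^ k * of_nat \<beta> ^ k *
       gen_stirling n k (of_nat \<alpha>) (of_nat \<beta>) (of_nat \<gamma>))"
proof -
  from assms obtain b c where bc: "\<beta> = b * \<alpha>" "\<gamma> = c * \<alpha>"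
    by (metis dvd_def mult.commute)
  define H :: "'a \<Rightarrow> 'a fps" where "H = fps_one_plus_power (of_nat \<alpha>)"
  define u where "u = u_series x (of_nat \<alpha>) (of_nat \<beta>)"
  let ?S = "\<lambda>k. gen_stirling n k (of_nat \<alpha>) (of_nat \<beta>) (of_nat \<gamma>) :: 'a"
  let ?g = "fps_nth (r_derangement_egf r :: 'a fps)"
  have u0: "fps_nth u 0 = 0" by (simp add: u_def u_series_nth_0)
  have S: "fact k * of_nat \<beta> ^ k * ?S k =
      fact n * fps_nth (H (of_nat \<gamma>) * (H (of_nat \<beta>) - 1) ^ k) n" for k
    unfolding H_def by (rule gen_stirling_egf[of _ b _ _ c]) (simp_all add: bc)
  have uk: "fps_nth (H (of_nat \<gamma>) * u ^ k) n =
      x ^ k * fps_nth (H (of_nat \<gamma>) * (H (of_nat \<beta>) - 1) ^ k) n" for k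
    by (simp add: u_def u_series_def H_def power_mult_distrib mult.left_commute[of _ "fps_const _"])
  have "B_series r x 1 (of_nat \<alpha>) (of_nat \<beta>) (of_nat \<gamma>) =
      H (of_nat \<gamma>) * (r_derangement_egf r oo u)"
    unfolding r_derangement_egf_compose[OF u0] unfolding B_series_def Let_def H_def u_def
    by (simp del: power_Suc)
  then have "B_number r x n 1 (of_nat \<alpha>) (of_nat \<beta>) (of_nat \<gamma>) =
      fact n * (\<Sum>k\<le>n. ?g k * fps_nth (H (of_nat \<gamma>) * u ^ k) n)"
    by (simp add: B_number_def fps_nth_mult_compose[OF u0])
  \<comment> \<open>The \<open>fact k\<close> supplied by the Stirling identity is what turns
    \<open>?g k\<close> into the \<open>r\<close>-derangement number.\<close>
  also have "\<dots> = (\<Sum>k\<le>n. ?g k * x ^ k * (fact k * of_nat \<beta> ^ k * ?S k))"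
    unfolding S uk by (simp add: sum_distrib_left mult_ac)
  also have "\<dots> = (\<Sum>k\<le>n. of_nat (r_derangement_number k r) * x ^ k * of_nat \<beta> ^ k * ?S k)"
    unfolding r_derangement_number_eq by (simp add: mult_ac)
  finally show ?thesis .
qed

end
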